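(* For every irrational $a\in(0,1)$, the quantities $A_O(a)$, $A_P(a)$, $A_L(a)$ are finite and (i) $|A_O(a)|_a\le 4$; (ii) $|A_P(a)|_a\le 4$; (iii) $|A_L(a)|_a\le 6$; (iv) $A_O(a)\le A_P(a)\le A_L(a)=2A_O(a)$. Moreover, there are irrational numbers $a,\beta\in(0,1)$ such that $A_O(a)=A_P(a)$ and $A_P(\beta)=A_L(\beta)$.
   Context: For irrational $a$ the characteristic Sturmian word is $c_{a,0}=c_{a,0}(1)c_{a,0}(2)\cdots$ with $c_{a,0}(n)=\lfloor a(n+1)\rfloor-\lfloor an\rfloor-\lfloor a\rfloor$. For $w\in\{0,1\}^*$, $\overline{w}$ is obtained by exchanging $0$ and $1$, and $w^R$ is the reversal of $w$. A word is an antisquare if it equals $v\overline{v}$ for some word $v$ (its order is $|v|$), and an antipalindrome if $w=\overline{w^R}$. A factor of $c_{a,0}$ is a finite word $c_{a,0}(i)\cdots c_{a,0}(j)$. $A_O(a)$ is the maximum order of an antisquare factor of $c_{a,0}$, $A_L(a)$ the maximum length of an antisquare factor, $A_P(a)$ the maximum length of an antipalindrome factor (each is $\infty$ if no maximum exists). For $a=[0;a_1,a_2,\dots]$ let $q_{-1}=0,q_0=1,q_n=a_nq_{n-1}+q_{n-2}$; every $N\in\mathbb{N}$ is uniquely $N=\sum_{n=0}^{M}b_{n+1}q_n$ with $0\le b_1<a_1$, $0\le b_{n+1}\le a_{n+1}$, $b_n=0$ whenever $b_{n+1}=a_{n+1}$ (the $a$-Ostrowski representation $b_1b_2\cdots$).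 $|N|_a$ is the index of the last nonzero digit of this representation, or $0$ if $N=0$. *)

theory Defs
  imports Complex_Main "HOL-Library.Extended_Nat"
begin

text \<open>The letters are the integers \<open>0\<close> and \<open>1\<close>.\<close>

definition sturmian :: "real \<Rightarrow> nat \<Rightarrow> int" where
  "sturmian a n = \<lfloor>a * real (n + 1)\<rfloor> - \<lfloor>a * real n\<rfloor> - \<lfloor>a\<rfloor>"

text \<open>The word starts at index \<open>1\<close>; the case \<open>j < i\<close> gives the empty factor.\<close>

definition is_factor :: "real \<Rightarrow> int list \<Rightarrow> bool" where
  "is_factor a w \<longleftrightarrow> (\<exists>i j. 1 \<le> i \<and> w = map (sturmian a) [i..<Suc j])"

definition exchange :: "int list \<Rightarrow> int list" where
  "exchange w = map (\<lambda>x. 1 - x) w"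

definition antisquare_of_order :: "nat \<Rightarrow> int list \<Rightarrow> bool" where
  "antisquare_of_order k w \<longleftrightarrow>
     (\<exists>v. set v \<subseteq> {0, 1} \<and> length v = k \<and> w = v @ exchange v)"

definition antisquare :: "int list \<Rightarrow> bool" where
  "antisquare w \<longleftrightarrow> (\<exists>k. antisquare_of_order k w)"

definition antipalindrome :: "int list \<Rightarrow> bool" where
  "antipalindrome w \<longleftrightarrow> set w \<subseteq> {0, 1} \<and> w = exchange (rev w)"

definition max_or_infinity :: "nat set \<Rightarrow> enat" where
  "max_or_infinity S = (if \<exists>m\<in>S. \<forall>n\<in>S. n \<le> m then enat (Max S) else \<infinity>)"

definition A_O :: "real \<Rightarrow> enat" where
  "A_O a = max_or_infinity {k. \<exists>w. is_factor a w \<and> antisquare_of_order k w}"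

definition A_L :: "real \<Rightarrow> enat" where
  "A_L a = max_or_infinity {length w |w. is_factor a w \<and> antisquare w}"

definition A_P :: "real \<Rightarrow> enat" where
  "A_P a = max_or_infinity {length w |w. is_factor a w \<and> antipalindrome w}"

text \<open>Complete quotients and partial quotients of the regular continued fraction
  expansion of an irrational number \<open>a > 0\<close>.\<close>

fun cf_complete :: "real \<Rightarrow> nat \<Rightarrow> real" where
  "cf_complete a 0 = a"
| "cf_complete a (Suc n) = 1 / frac (cf_complete a n)"

definition cf_coeff :: "real \<Rightarrow> nat \<Rightarrow> nat" where
  "cf_coeff a n = nat \<lfloor>cf_complete a n\<rfloor>"

text \<open>The value at \<open>1\<close> is \<open>a\<^sub>1 q\<^sub>0 + q\<^sub>-\<^sub>1\<close> with \<open>q\<^sub>0 = 1\<close> and \<open>q\<^sub>-\<^sub>1 = 0\<close>.\<close>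

fun cf_denom :: "real \<Rightarrow> nat \<Rightarrow> nat" where
  "cf_denom a 0 = 1"
| "cf_denom a (Suc 0) = cf_coeff a 1"
| "cf_denom a (Suc (Suc n)) = cf_coeff a (Suc (Suc n)) * cf_denom a (Suc n) + cf_denom a n"

text \<open>The digits are \<open>b 1, b 2, \<dots>\<close>, padded with zeros beyond the last digit. The unused
  value \<open>b 0\<close> is set to \<open>0\<close> so that the digit function is unique.\<close>

definition is_ostrowski_rep :: "real \<Rightarrow> nat \<Rightarrow> (nat \<Rightarrow> nat) \<Rightarrow> bool" where
  "is_ostrowski_rep a N b \<longleftrightarrow>
     b 0 = 0 \<and>
     (\<exists>M. (\<forall>n > M + 1. b n = 0) \<and> N = (\<Sum>n=0..M. b (n + 1) * cf_denom a n)) \<and>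
     b 1 < cf_coeff a 1 \<and>
     (\<forall>n. b (n + 1) \<le> cf_coeff a (n + 1)) \<and>
     (\<forall>n \<ge> 1. b (n + 1) = cf_coeff a (n + 1) \<longrightarrow> b n = 0)"

definition ostrowski_rep :: "real \<Rightarrow> nat \<Rightarrow> nat \<Rightarrow> nat" where
  "ostrowski_rep a N = (THE b. is_ostrowski_rep a N b)"

definition ostrowski_length :: "real \<Rightarrow> nat \<Rightarrow> nat" where
  "ostrowski_length a N = (if N = 0 then 0 else Max {n. ostrowski_rep a N n \<noteq> 0})"

end

theory Submission
  imports Defs "HOL-Analysis.Kronecker_Approximation_Theorem"
begin

text \<open>By density of the multiples of \<open>a\<close> modulo \<open>1\<close>, the factors are exactly the codings of the
  rotation by \<open>a\<close> with an arbitrary starting point. Exchanging the letters replaces \<open>a\<close> by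
  \<open>1 - a\<close>, so let \<open>a < 1/2\<close> and \<open>d = 1 - 2 a\<close>. Half of the letters of an antisquare are ones,
  so its order \<open>k\<close> satisfies \<open>k d < 1\<close>; an antipalindrome has even length \<open>2 m\<close>, and discarding
  an outer zero gives \<open>m d < 1 - a\<close>. Conversely, \<open>(10)\<^sup>m\<close> is a factor if \<open>m d < 1 - a\<close>, and
  \<open>(10)\<^sup>j(01)\<^sup>j\<close> is one if \<open>2 j d < 1\<close>. Since \<open>(1 + d) / 2 = 1 - a\<close>, these conditions
  give \<open>A_O \<le> A_P \<le> 2 A_O\<close>. The condition \<open>m d < 1 - a\<close> bounds \<open>m\<close> by the partial
  quotients, which yields \<open>A_P < q\<^sub>4\<close> and hence \<open>A_L \<le> 2 A_P < q\<^sub>6\<close>; and a number below \<open>q\<^sub>n\<close>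
  has at most \<open>n\<close> Ostrowski digits.\<close>

section \<open>Ostrowski representations\<close>

lemma cf_complete_irrational:
  assumes "a \<notin> \<rat>"
  shows "cf_complete a n \<notin> \<rat>"
proof (induction n)
  case (Suc n)
  show ?case
  proof
    assume "cf_complete a (Suc n) \<in> \<rat>"
    then have "inverse (cf_complete a (Suc n)) \<in> \<rat>"
      by (rule Rats_inverse)
    then have "frac (cf_complete a n) \<in> \<rat>"
      by (simp add: inverse_eq_divide)
    then have "frac (cf_complete a n) + of_int \<lfloor>cf_complete a n\<rfloor> \<in> \<rat>"
      by (intro Rats_add) auto
    with Suc show False
      by (simp add: frac_def)
  qed
qed (use assms in simp)

lemma cf_complete_Suc_gt_1:
  assumes "a \<notin> \<rat>"
  shows "cf_complete a (Suc n) > 1"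
proof -
  have "cf_complete a n \<notin> \<int>"
    using cf_complete_irrational[OF assms] Ints_subset_Rats by blast
  then have "frac (cf_complete a n) > 0"
    by (simp add: frac_gt_0_iff)
  then show ?thesis
    using frac_lt_1[of "cf_complete a n"] by simp
qed

lemma cf_complete_less:
  assumes "a \<notin> \<rat>"
  shows "cf_complete a (Suc n) < real (cf_coeff a (Suc n)) + 1"
  using cf_complete_Suc_gt_1[OF assms, of n] unfolding cf_coeff_def by linarith

lemma cf_coeff_pos:
  assumes "a \<notin> \<rat>"
  shows "cf_coeff a (Suc n) \<ge> 1"
  using cf_complete_Suc_gt_1[OF assms, of n] unfolding cf_coeff_def by linarith

lemma cf_complete_eq:
  assumes "a \<notin> \<rat>"
  shows "cf_complete a (Suc n) = cf_coeff a (Suc n) + 1 / cf_complete a (Suc (Suc n))"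
proof -
  have "\<lfloor>cf_complete a (Suc n)\<rfloor> \<ge> 0"
    using cf_complete_Suc_gt_1[OF assms, of n] by linarith
  then have "real (cf_coeff a (Suc n)) = of_int \<lfloor>cf_complete a (Suc n)\<rfloor>"
    by (simp add: cf_coeff_def)
  then show ?thesis
    by (simp add: frac_def)
qed

lemma cf_denom_pos:
  assumes "a \<notin> \<rat>"
  shows "cf_denom a n \<ge> 1"
proof (induction n rule: less_induct)
  case (less n)
  consider "n = 0" | "n = Suc 0" | m where "n = Suc (Suc m)"
    by (metis not0_implies_Suc)
  then show ?case
    using less.IH cf_coeff_pos[OF assms, of 0] by cases (auto simp: trans_le_add2)
qed

lemma cf_denom_add_le:
  assumes "a \<notin> \<rat>"
  shows "cf_denom a (Suc n) + cf_denom a n \<le> cf_denom a (Suc (Suc n))"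
  using mult_right_mono[OF cf_coeff_pos[OF assms, of "Suc n"], of "cf_denom a (Suc n)"] by simp

lemma cf_denom_le_Suc:
  assumes "a \<notin> \<rat>"
  shows "cf_denom a n \<le> cf_denom a (Suc n)"
proof (cases n)
  case (Suc m)
  then show ?thesis
    using cf_denom_add_le[OF assms, of m] by (simp del: cf_denom.simps)
qed (use cf_coeff_pos[OF assms, of 0] in simp)

lemma cf_denom_mono:
  assumes "a \<notin> \<rat>" "m \<le> n"
  shows "cf_denom a m \<le> cf_denom a n"
  using assms(2) by (rule lift_Suc_mono_le[of "cf_denom a", OF cf_denom_le_Suc[OF assms(1)]])

section \<open>Existence, uniqueness and length of Ostrowski representations\<close>

definition ostrowski_digits :: "real \<Rightarrow> (nat \<Rightarrow> nat) \<Rightarrow> bool" where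
  "ostrowski_digits a b \<longleftrightarrow> b 0 = 0 \<and> b 1 < cf_coeff a 1 \<and>
     (\<forall>n. b (n + 1) \<le> cf_coeff a (n + 1)) \<and>
     (\<forall>n \<ge> 1. b (n + 1) = cf_coeff a (n + 1) \<longrightarrow> b n = 0)"

text \<open>Separates the conditions on the digits from the value and admits the empty sum, so that
  inductions on the number of digits can start at 0.\<close>

lemma is_ostrowski_rep_iff:
  "is_ostrowski_rep a N b \<longleftrightarrow> ostrowski_digits a b \<and>
     (\<exists>M. (\<forall>n > M. b n = 0) \<and> N = (\<Sum>n<M. b (Suc n) * cf_denom a n))"
proof -
  have "(\<exists>M. (\<forall>n > M + 1. b n = 0) \<and> N = (\<Sum>n=0..M. b (n + 1) * cf_denom a n)) \<longleftrightarrow>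
        (\<exists>M. (\<forall>n > M. b n = 0) \<and> N = (\<Sum>n<M. b (Suc n) * cf_denom a n))" (is "?L \<longleftrightarrow> ?R")
  proof
    assume ?L
    then obtain M where "\<forall>n > M + 1. b n = 0" "N = (\<Sum>n=0..M. b (n + 1) * cf_denom a n)"
      by blast
    then show ?R
      by (intro exI[of _ "Suc M"]) (simp add: atLeast0AtMost lessThan_Suc_atMost)
  next
    assume ?R
    then obtain M where "\<forall>n > M. b n = 0" "N = (\<Sum>n<M. b (Suc n) * cf_denom a n)"
      by blast
    \<comment> \<open>The sum over \<open>0..M\<close> has one more summand; its digit
      \<open>b (M + 1)\<close> vanishes.\<close>
    then show ?L
      by (intro exI[of _ M]) (simp add: atLeast0AtMost flip: lessThan_Suc_atMost)
  qed
  then show ?thesis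
    unfolding is_ostrowski_rep_def ostrowski_digits_def by blast
qed

text \<open>Two-step induction. If the top digit is maximal, the digit below it is 0, and the
  recursion for \<open>cf_denom\<close> leaves room for the sum of the remaining digits. Otherwise
  one multiple of \<open>cf_denom a (m - 1)\<close> is still free, and it exceeds the sum of the
  lower digits.\<close>

lemma ostrowski_partial_sum_less:
  assumes "a \<notin> \<rat>" "ostrowski_digits a b"
  shows "(\<Sum>n<m. b (Suc n) * cf_denom a n) < cf_denom a m"
proof (induction m rule: less_induct)
  case (less m)
  consider "m = 0" | "m = Suc 0" | k where "m = Suc (Suc k)"
    by (metis not0_implies_Suc)
  then show ?case
  proof cases
    case (3 k)
    have le: "b m \<le> cf_coeff a m" and eq: "b m = cf_coeff a m \<Longrightarrow> b (Suc k) = 0"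
      using assms(2) 3 by (auto simp: ostrowski_digits_def)
    show ?thesis
    proof (cases "b m = cf_coeff a m")
      case True
      then show ?thesis
        using less.IH[of k] eq 3 by simp
    next
      case False
      with le have "Suc (b m) * cf_denom a (Suc k) \<le> cf_coeff a m * cf_denom a (Suc k)"
        by (intro mult_right_mono) auto
      then show ?thesis
        using less.IH[of "Suc k"] 3 by simp
    qed
  qed (use assms(2) in \<open>auto simp: ostrowski_digits_def\<close>)
qed

text \<open>The lower digits sum to less than \<open>cf_denom a m\<close>, so the top digit is the
  quotient of the common value by \<open>cf_denom a m\<close>. The digits are recovered from the top
  down.\<close>

lemma ostrowski_digits_unique:
  assumes "a \<notin> \<rat>" "ostrowski_digits a b" "ostrowski_digits a b'"
    and "(\<Sum>n<m. b (Suc n) * cf_denom a n) = (\<Sum>n<m. b' (Suc n) * cf_denom a n)"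
    and "n < m"
  shows "b (Suc n) = b' (Suc n)"
  using assms(4,5)
proof (induction m)
  case (Suc m)
  let ?S = "\<lambda>b. \<Sum>n<m. b (Suc n) * cf_denom a n"
  have lt: "?S b < cf_denom a m" "?S b' < cf_denom a m"
    using ostrowski_partial_sum_less assms by auto
  have eq: "?S b + b (Suc m) * cf_denom a m = ?S b' + b' (Suc m) * cf_denom a m"
    using Suc.prems by simp
  have "b (Suc m) = (?S b + b (Suc m) * cf_denom a m) div cf_denom a m"
    using lt by simp
  also have "\<dots> = b' (Suc m)"
    unfolding eq using lt by simp
  finally have "b (Suc m) = b' (Suc m)" .
  with eq Suc show ?case
    by (cases "n = m") auto
qed simp

lemma is_ostrowski_rep_unique:
  assumes "a \<notin> \<rat>" "is_ostrowski_rep a N b" "is_ostrowski_rep a N b'"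
  shows "b = b'"
proof -
  \<comment> \<open>The two representations may be cut off at different places; zero digits pad both
    to the common length \<open>?K\<close> below.\<close>
  have extend: "N = (\<Sum>n<K. c (Suc n) * cf_denom a n)"
    if "N = (\<Sum>n<M. c (Suc n) * cf_denom a n)" "\<forall>n > M. c n = 0" "M \<le> K" for c M K
    unfolding that(1) by (rule sum.mono_neutral_left) (use that in auto)
  obtain M where M: "\<forall>n > M. b n = 0" "N = (\<Sum>n<M. b (Suc n) * cf_denom a n)"
    using assms(2) is_ostrowski_rep_iff by auto
  obtain M' where M': "\<forall>n > M'. b' n = 0" "N = (\<Sum>n<M'. b' (Suc n) * cf_denom a n)"
    using assms(3) is_ostrowski_rep_iff by auto
  have digits: "ostrowski_digits a b" "ostrowski_digits a b'"
    using assms is_ostrowski_rep_iff by auto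
  let ?K = "max M M'"
  have "(\<Sum>n<?K. b (Suc n) * cf_denom a n) = (\<Sum>n<?K. b' (Suc n) * cf_denom a n)"
    using extend[OF M(2) M(1), of ?K] extend[OF M'(2) M'(1), of ?K] by simp
  then have eq: "b (Suc n) = b' (Suc n)" if "n < ?K" for n
    using ostrowski_digits_unique[OF assms(1) digits] that by blast
  show ?thesis
  proof
    fix n
    show "b n = b' n"
    proof (cases n)
      case 0
      then show ?thesis
        using digits by (simp add: ostrowski_digits_def)
    next
      case (Suc i)
      then show ?thesis
        using eq[of i] M(1) M'(1) by (cases "i < ?K") auto
    qed
  qed
qed

text \<open>Greedy algorithm: the top digit is the quotient of \<open>N\<close> by the largest
  available denominator, and the remainder is expanded by induction.\<close>

lemma ostrowski_digits_exist:
  assumes "a \<notin> \<rat>" "N < cf_denom a m"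
  shows "\<exists>b. ostrowski_digits a b \<and> (\<forall>n > m. b n = 0) \<and>
           N = (\<Sum>n<m. b (Suc n) * cf_denom a n)"
  using assms(2)
proof (induction m arbitrary: N rule: less_induct)
  case (less m)
  have pos: "cf_coeff a (Suc n) > 0" for n
    using cf_coeff_pos[OF assms(1), of n] by simp
  consider "m = 0" | "m = Suc 0" | k where "m = Suc (Suc k)"
    by (metis not0_implies_Suc)
  then show ?case
  proof cases
    case 1
    then show ?thesis
      using less.prems pos[of 0] by (intro exI[of _ "\<lambda>_. 0"]) (auto simp: ostrowski_digits_def)
  next
    case 2
    then show ?thesis
      using less.prems pos
      by (intro exI[of _ "(\<lambda>_. 0)(1 := N)"]) (auto simp: ostrowski_digits_def dest: less_not_refl2)
  next
    case (3 k)
    let ?q = "cf_denom a (Suc k)"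
    define d r where "d = N div ?q" and "r = N mod ?q"
    have N: "N = d * ?q + r"
      unfolding d_def r_def by (rule div_mult_mod_eq[symmetric])
    have r: "r < ?q"
      using cf_denom_pos[OF assms(1), of "Suc k"] by (simp add: r_def)
    have N_less: "N < cf_coeff a m * ?q + cf_denom a k"
      using less.prems 3 by simp
    also have "\<dots> \<le> Suc (cf_coeff a m) * ?q"
      using cf_denom_le_Suc[OF assms(1), of k] by simp
    finally have d: "d \<le> cf_coeff a m"
      unfolding d_def by (simp add: less_mult_imp_div_less less_Suc_eq_le flip: less_Suc_eq_le)
    \<comment> \<open>A maximal top digit leaves a remainder below \<open>cf_denom a k\<close>. The
      induction hypothesis is then applied two indices down, which makes the digit at
      \<open>Suc k\<close> vanish.\<close>
    have "\<exists>b. ostrowski_digits a b \<and> (\<forall>n > Suc k. b n = 0) \<and>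
            r = (\<Sum>n<Suc k. b (Suc n) * cf_denom a n) \<and> (d = cf_coeff a m \<longrightarrow> b (Suc k) = 0)"
    proof (cases "d = cf_coeff a m")
      case True
      with N N_less have "r < cf_denom a k"
        by simp
      with less.IH[of k r] 3 obtain b where "ostrowski_digits a b" "\<forall>n > k. b n = 0"
          "r = (\<Sum>n<k. b (Suc n) * cf_denom a n)"
        by auto
      then show ?thesis
        by (intro exI[of _ b]) auto
    next
      case False
      then show ?thesis
        using less.IH[of "Suc k" r] 3 r by auto
    qed
    then obtain b where b: "ostrowski_digits a b" "\<forall>n > Suc k. b n = 0"
        "r = (\<Sum>n<Suc k. b (Suc n) * cf_denom a n)" "d = cf_coeff a m \<longrightarrow> b (Suc k) = 0"
      by blast
    let ?b = "b(m := d)"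
    have "ostrowski_digits a ?b"
      unfolding ostrowski_digits_def
    proof (intro conjI allI impI)
      fix n
      show "?b (n + 1) \<le> cf_coeff a (n + 1)"
        using b(1) d by (auto simp: ostrowski_digits_def)
      assume n: "1 \<le> n" "?b (n + 1) = cf_coeff a (n + 1)"
      show "?b n = 0"
      proof (cases "n + 1 = m")
        case True
        then show ?thesis
          using n b(4) 3 by auto
      next
        case False
        with n have "b (n + 1) = cf_coeff a (n + 1)"
          by auto
        \<comment> \<open>A digit that attains its positive partial quotient is nonzero, so it lies
          within the support of \<open>b\<close>.\<close>
        moreover from this have "n + 1 \<le> Suc k"
          using b(2) pos[of n] by (metis Suc_eq_plus1 linorder_not_less not_gr_zero)
        moreover have "b (n + 1) = cf_coeff a (n + 1) \<Longrightarrow> b n = 0"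
          using b(1) n(1) unfolding ostrowski_digits_def by blast
        ultimately show ?thesis
          using 3 by simp
      qed
    qed (use b(1) 3 in \<open>auto simp: ostrowski_digits_def\<close>)
    moreover have "(\<Sum>n<Suc k. ?b (Suc n) * cf_denom a n) = r"
      unfolding b(3) by (rule sum.cong) (use 3 in auto)
    then have "N = (\<Sum>n<m. ?b (Suc n) * cf_denom a n)"
      using 3 N by simp
    moreover have "\<forall>n > m. ?b n = 0"
      using b(2) 3 by simp
    ultimately show ?thesis
      by blast
  qed
qed

text \<open>The greedy digits sit at positions up to \<open>m\<close>, and by uniqueness they are
  the digits selected by \<open>THE\<close>.\<close>

lemma ostrowski_length_le:
  assumes "a \<notin> \<rat>" "N < cf_denom a m"
  shows "ostrowski_length a N \<le> m"
proof (cases "N = 0")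
  case False
  obtain b where b: "ostrowski_digits a b" "\<forall>n > m. b n = 0"
      "N = (\<Sum>n<m. b (Suc n) * cf_denom a n)"
    using ostrowski_digits_exist[OF assms] by blast
  then have rep: "is_ostrowski_rep a N b"
    by (auto simp: is_ostrowski_rep_iff)
  then have "ostrowski_rep a N = b"
    unfolding ostrowski_rep_def using is_ostrowski_rep_unique[OF assms(1)] by blast
  moreover have sub: "{n. b n \<noteq> 0} \<subseteq> {..m}"
    using b(2) by (auto simp: not_less[symmetric])
  moreover have "\<exists>n. b n \<noteq> 0"
    using b(3) False by (metis (no_types, lifting) mult_zero_left sum.neutral)
  ultimately show ?thesis
    using False finite_subset[OF sub] by (auto simp: ostrowski_length_def)
qed (simp add: ostrowski_length_def)

section \<open>Factors as codings of a rotation\<close>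

text \<open>The letter is 1 exactly when the step from \<open>x + a m\<close> to
  \<open>x + a (m + 1)\<close> passes or reaches an integer (for \<open>0 < a < 1\<close>). As a
  difference of floors it telescopes in sums.\<close>

definition rotation_letter :: "real \<Rightarrow> real \<Rightarrow> nat \<Rightarrow> int" where
  "rotation_letter a x m = \<lfloor>x + a * real (Suc m)\<rfloor> - \<lfloor>x + a * real m\<rfloor>"

lemma rotation_letter_01:
  assumes "0 < a" "a < 1"
  shows "rotation_letter a x m \<in> {0, 1}"
proof -
  have "x + a * real (Suc m) = (x + a * real m) + a"
    by (simp add: algebra_simps)
  then have "rotation_letter a x m = 0 \<or> rotation_letter a x m = 1"
    unfolding rotation_letter_def using assms by linarith
  then show ?thesis
    by simp
qed

lemma sum_rotation_letter:
  assumes "m \<le> n"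
  shows "(\<Sum>i=m..<n. rotation_letter a x i) = \<lfloor>x + a * real n\<rfloor> - \<lfloor>x + a * real m\<rfloor>"
  using sum_Suc_diff'[OF assms, of "\<lambda>i. \<lfloor>x + a * real i\<rfloor>"]
  by (simp add: rotation_letter_def)

text \<open>A difference of floors exceeds the difference of the arguments by less than 1. This
  bound on the number of ones is the source of the upper bounds on antisquares and
  antipalindromes.\<close>

lemma sum_rotation_letter_less:
  assumes "m \<le> n"
  shows "real_of_int (\<Sum>i=m..<n. rotation_letter a x i) < a * (real n - real m) + 1"
  unfolding sum_rotation_letter[OF assms] by (simp add: algebra_simps) linarith

lemma sturmian_eq_rotation_letter:
  assumes "0 < a" "a < 1"
  shows "sturmian a (i + m) = rotation_letter a (a * real i) m"
  using assms by (simp add: sturmian_def rotation_letter_def algebra_simps floor_eq_iff)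

text \<open>The floor is right-continuous and locally constant from the right; finitely many shifts
  \<open>f m\<close> share one \<open>e\<close>.\<close>

lemma floor_right_stable:
  fixes f :: "nat \<Rightarrow> real"
  obtains e where "e > 0"
    "\<And>y m. \<lbrakk>x \<le> y; y < x + e; m \<le> L\<rbrakk> \<Longrightarrow> \<lfloor>y + f m\<rfloor> = \<lfloor>x + f m\<rfloor>"
proof
  let ?E = "(\<lambda>m. 1 - frac (x + f m)) ` {..L}"
  show "Min ?E > 0"
    by (simp add: frac_lt_1)
  fix y m
  assume "x \<le> y" "y < x + Min ?E" "m \<le> L"
  moreover from this have "Min ?E \<le> 1 - frac (x + f m)"
    by (intro Min_le) auto
  ultimately show "\<lfloor>y + f m\<rfloor> = \<lfloor>x + f m\<rfloor>"
    unfolding frac_def by linarith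
qed

text \<open>A factor at position \<open>i\<close> is the coding with starting point
  \<open>a i\<close>. Conversely, the letters of a finite coding do not change when \<open>x\<close>
  moves slightly to the right, and some multiple of \<open>a\<close> with a positive factor lands
  there modulo 1.\<close>

lemma is_factor_iff_rotation:
  assumes "a \<notin> \<rat>" "0 < a" "a < 1"
  shows "is_factor a w \<longleftrightarrow> (\<exists>x. w = map (rotation_letter a x) [0..<length w])"
proof
  assume "is_factor a w"
  then obtain i j where w: "w = map (sturmian a) [i..<Suc j]"
    unfolding is_factor_def by blast
  have "w = map (rotation_letter a (a * real i)) [0..<length w]"
    by (rule nth_equalityI)
      (use sturmian_eq_rotation_letter[OF assms(2,3)] in \<open>auto simp: w simp del: upt_Suc\<close>)
  then show "\<exists>x. w = map (rotation_letter a x) [0..<length w]" ..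
next
  assume "\<exists>x. w = map (rotation_letter a x) [0..<length w]"
  then obtain x where x: "w = map (rotation_letter a x) [0..<length w]" ..
  obtain e where e: "e > 0"
      "\<And>y m. \<lbrakk>x \<le> y; y < x + e; m \<le> length w\<rbrakk> \<Longrightarrow>
        \<lfloor>y + a * real m\<rfloor> = \<lfloor>x + a * real m\<rfloor>"
    using floor_right_stable[of x "length w" "\<lambda>m. a * real m"] by blast
  obtain h k where hk: "k > 0" "\<bar>of_int k * a - of_int h - (x + e / 2)\<bar> < e / 2"
    using sequence_of_fractional_parts_is_dense[OF assms(1), of "e / 2" "x + e / 2"] e(1)
    by (metis half_gt_zero)
  define i where "i = nat k"
  have i: "i \<ge> 1" "real_of_int k = real i"
    using hk(1) by (auto simp: i_def)
  \<comment> \<open>The integer \<open>h\<close> shifts all floors equally and cancels in the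
    letters.\<close>
  have "\<lfloor>a * real i + a * real m\<rfloor> = \<lfloor>x + a * real m\<rfloor> + h" if "m \<le> length w" for m
  proof -
    have "\<lfloor>(a * real i - of_int h) + a * real m\<rfloor> = \<lfloor>x + a * real m\<rfloor>"
    proof (rule e(2))
      have "\<bar>a * real i - of_int h - (x + e / 2)\<bar> < e / 2"
        using hk(2) i(2) by (simp add: mult.commute)
      then show "x \<le> a * real i - of_int h" "a * real i - of_int h < x + e"
        by linarith+
    qed (use that in simp)
    moreover have "a * real i + a * real m = (a * real i - of_int h) + a * real m + of_int h"
      by simp
    ultimately show ?thesis
      by (metis floor_add_int)
  qed
  then have letters: "sturmian a (i + m) = rotation_letter a x m" if "m < length w" for m
    using that sturmian_eq_rotation_letter[OF assms(2,3), of i m]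
    by (simp add: rotation_letter_def Suc_leI del: of_nat_Suc)
  have "map (sturmian a) [i..<i + length w] = map (rotation_letter a x) [0..<length w]"
    by (rule nth_equalityI) (use letters in auto)
  \<comment> \<open>The right end of the factor is \<open>i + length w - 1\<close>; since
    \<open>i\<close> is positive, this also covers the empty word.\<close>
  moreover have "Suc (i + length w - 1) = i + length w"
    using i(1) by simp
  ultimately show "is_factor a w"
    unfolding is_factor_def using i(1) x by metis
qed

section \<open>Antisquares and antipalindromes in terms of the starting point\<close>

definition antisquare_orders :: "real \<Rightarrow> nat set" where
  "antisquare_orders a = {k. \<exists>w. is_factor a w \<and> antisquare_of_order k w}"

definition antipalindrome_lengths :: "real \<Rightarrow> nat set" where
  "antipalindrome_lengths a = {length w |w. is_factor a w \<and> antipalindrome w}"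

lemma antisquare_orders_iff:
  assumes "a \<notin> \<rat>" "0 < a" "a < 1"
  shows "k \<in> antisquare_orders a \<longleftrightarrow>
           (\<exists>x. \<forall>m<k. rotation_letter a x (k + m) = 1 - rotation_letter a x m)"
proof
  assume "k \<in> antisquare_orders a"
  then obtain w v where w: "is_factor a w" "length v = k" "w = v @ exchange v"
    by (auto simp: antisquare_orders_def antisquare_of_order_def)
  then obtain x where x: "w = map (rotation_letter a x) [0..<length w]"
    using is_factor_iff_rotation[OF assms] by blast
  have len: "length w = 2 * k"
    using w by (simp add: exchange_def)
  have "w ! m = rotation_letter a x m" if "m < 2 * k" for m
    using that len by (subst x) simp
  moreover have "w ! (k + m) = 1 - w ! m" if "m < k" for m
    using that w by (simp add: exchange_def nth_append)
  ultimately have "\<forall>m<k. rotation_letter a x (k + m) = 1 - rotation_letter a x m"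
    by (metis add_less_cancel_left mult_2 trans_less_add1)
  then show "\<exists>x. \<forall>m<k. rotation_letter a x (k + m) = 1 - rotation_letter a x m" ..
next
  assume "\<exists>x. \<forall>m<k. rotation_letter a x (k + m) = 1 - rotation_letter a x m"
  then obtain x where x: "\<forall>m<k. rotation_letter a x (k + m) = 1 - rotation_letter a x m" ..
  let ?w = "map (rotation_letter a x) [0..<k + k]"
  let ?v = "map (rotation_letter a x) [0..<k]"
  have "?w = ?v @ exchange ?v"
  proof (rule nth_equalityI)
    fix i
    assume i: "i < length ?w"
    show "?w ! i = (?v @ exchange ?v) ! i"
      using x[rule_format, of "i - k"] i by (cases "i < k") (auto simp: exchange_def nth_append)
  qed (simp add: exchange_def)
  moreover have "set ?v \<subseteq> {0, 1}"
    using rotation_letter_01[OF assms(2,3)] by auto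
  ultimately have "antisquare_of_order k ?w"
    unfolding antisquare_of_order_def by (intro exI[of _ ?v]) simp
  moreover have "is_factor a ?w"
    using is_factor_iff_rotation[OF assms, of ?w] by auto
  ultimately show "k \<in> antisquare_orders a"
    unfolding antisquare_orders_def by blast
qed

lemma antipalindrome_lengths_iff:
  assumes "a \<notin> \<rat>" "0 < a" "a < 1"
  shows "l \<in> antipalindrome_lengths a \<longleftrightarrow>
           (\<exists>x. \<forall>m<l. rotation_letter a x m = 1 - rotation_letter a x (l - Suc m))"
proof
  assume "l \<in> antipalindrome_lengths a"
  then obtain w where w: "is_factor a w" "length w = l" "w = exchange (rev w)"
    by (auto simp: antipalindrome_lengths_def antipalindrome_def)
  then obtain x where x: "w = map (rotation_letter a x) [0..<length w]"
    using is_factor_iff_rotation[OF assms] by blast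
  have nth: "w ! m = rotation_letter a x m" if "m < l" for m
    using that w(2) by (subst x) simp
  have anti: "w ! m = 1 - w ! (l - Suc m)" if "m < l" for m
  proof -
    have "w ! m = exchange (rev w) ! m"
      using w(3) by simp
    also have "\<dots> = 1 - w ! (l - Suc m)"
      using that w(2) by (simp add: exchange_def rev_nth)
    finally show ?thesis .
  qed
  have "\<forall>m<l. rotation_letter a x m = 1 - rotation_letter a x (l - Suc m)"
    using nth anti by (metis diff_Suc_less gr_implies_not_zero not_gr_zero)
  then show "\<exists>x. \<forall>m<l. rotation_letter a x m = 1 - rotation_letter a x (l - Suc m)" ..
next
  assume "\<exists>x. \<forall>m<l. rotation_letter a x m = 1 - rotation_letter a x (l - Suc m)"
  then obtain x where x: "\<forall>m<l. rotation_letter a x m = 1 - rotation_letter a x (l - Suc m)" ..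
  let ?w = "map (rotation_letter a x) [0..<l]"
  have "?w = exchange (rev ?w)"
  proof (rule nth_equalityI)
    fix i
    assume "i < length ?w"
    then show "?w ! i = exchange (rev ?w) ! i"
      using x[rule_format, of i] by (simp add: exchange_def rev_nth)
  qed (simp add: exchange_def)
  moreover have "set ?w \<subseteq> {0, 1}"
    using rotation_letter_01[OF assms(2,3)] by auto
  ultimately have "antipalindrome ?w"
    unfolding antipalindrome_def by blast
  moreover have "is_factor a ?w"
    using is_factor_iff_rotation[OF assms, of ?w] by auto
  ultimately show "l \<in> antipalindrome_lengths a"
    unfolding antipalindrome_lengths_def by force
qed

text \<open>An interval is uncountable, the rationals are not.\<close>

lemma exists_irrational_between:
  fixes x y :: real
  assumes "x < y"
  obtains a where "a \<notin> \<rat>" "x < a" "a < y"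
proof -
  have "\<not> {x<..<y} \<subseteq> \<rat>"
    using assms uncountable_open_interval[of x y] countable_rat countable_subset by blast
  with that show thesis
    by (meson greaterThanLessThan_iff subsetI)
qed

section \<open>Slopes below one half\<close>

text \<open>The letters at \<open>m\<close> and \<open>k + m\<close> add up to 1, so exactly
  \<open>k\<close> of the \<open>2 k\<close> letters are ones.\<close>

lemma antisquare_order_less:
  assumes "a \<notin> \<rat>" "0 < a" "a < 1" "k \<in> antisquare_orders a"
  shows "real k * (1 - 2 * a) < 1"
proof -
  obtain x where x: "\<And>m. m < k \<Longrightarrow> rotation_letter a x (k + m) = 1 - rotation_letter a x m"
    using antisquare_orders_iff[OF assms(1-3)] assms(4) by blast
  have "(\<Sum>m=0..<k + k. rotation_letter a x m) =
        (\<Sum>m=0..<k. rotation_letter a x m) + (\<Sum>m=0..<k. rotation_letter a x (k + m))"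
    using sum.atLeastLessThan_concat[of 0 k "k + k" "rotation_letter a x"]
      sum.shift_bounds_nat_ivl[of "rotation_letter a x" 0 k k]
    by (simp add: add.commute)
  also have "\<dots> = (\<Sum>m=0..<k. rotation_letter a x m + rotation_letter a x (k + m))"
    by (simp add: sum.distrib)
  also have "\<dots> = int k"
    by (simp add: x)
  finally have "real k < a * real (k + k) + 1"
    using sum_rotation_letter_less[of 0 "k + k" a x] by simp
  then show ?thesis
    by (simp add: algebra_simps)
qed

text \<open>The first and the last letter differ; dropping the one that is \<open>0\<close> leaves
  \<open>2 m - 1\<close> letters with \<open>m\<close> ones.\<close>

lemma antipalindrome_length_less:
  assumes "a \<notin> \<rat>" "0 < a" "a < 1" "l \<in> antipalindrome_lengths a"
  obtains m where "l = 2 * m" "real m * (1 - 2 * a) < 1 - a"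
proof -
  obtain x where x: "\<And>m. m < l \<Longrightarrow> rotation_letter a x m = 1 - rotation_letter a x (l - Suc m)"
    using antipalindrome_lengths_iff[OF assms(1-3)] assms(4) by blast
  \<comment> \<open>The middle letter of an odd antipalindrome would be its own complement.\<close>
  have "even l"
  proof (rule ccontr)
    assume "odd l"
    then obtain n where "l = 2 * n + 1"
      by (elim oddE)
    then have "rotation_letter a x n = 1 - rotation_letter a x n"
      using x[of n] by simp
    then show False
      by presburger
  qed
  then obtain m where l: "l = 2 * m"
    by blast
  \<comment> \<open>Reversing the order of summation shows that there are as many ones as
    zeros.\<close>
  have "(\<Sum>i=0..<l. rotation_letter a x i) = (\<Sum>i=0..<l. rotation_letter a x (l - Suc i))"
    by (simp add: atLeast0LessThan sum.nat_diff_reindex)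
  also have "\<dots> = (\<Sum>i=0..<l. 1 - rotation_letter a x i)"
  proof (rule sum.cong)
    fix i
    assume "i \<in> {0..<l}"
    then show "rotation_letter a x (l - Suc i) = 1 - rotation_letter a x i"
      using x[of i] by simp
  qed simp
  also have "\<dots> = int l - (\<Sum>i=0..<l. rotation_letter a x i)"
    by (simp add: sum_subtractf)
  finally have total: "(\<Sum>i=0..<l. rotation_letter a x i) = int m"
    using l by simp
  have "real m * (1 - 2 * a) < 1 - a"
  proof (cases m)
    case (Suc n)
    have ends: "rotation_letter a x 0 = 1 - rotation_letter a x (2 * n + 1)"
      using x[of 0] l Suc by simp
    consider "rotation_letter a x (2 * n + 1) = 0" | "rotation_letter a x 0 = 0"
      using ends rotation_letter_01[OF assms(2,3), of x 0] by force
    then have "real m < a * real (2 * n + 1) + 1"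
    proof cases
      case 1
      then have "(\<Sum>i=0..<2 * n + 1. rotation_letter a x i) = int m"
        using total l Suc by simp
      then show ?thesis
        using sum_rotation_letter_less[of 0 "2 * n + 1" a x] by simp
    next
      case 2
      then have "(\<Sum>i=1..<2 * n + 2. rotation_letter a x i) = int m"
        using total l Suc sum.atLeast_Suc_lessThan[of 0 l "rotation_letter a x"] by simp
      then show ?thesis
        using sum_rotation_letter_less[of 1 "2 * n + 2" a x] by simp
    qed
    then show ?thesis
      using Suc by (simp add: algebra_simps)
  qed (use assms in simp)
  with l that show thesis
    by blast
qed

lemma int_div2_diff: "int (Suc n div 2) - int (n div 2) = (if even n then 0 else 1)"
proof (cases "even n")
  case False
  then obtain k where "n = 2 * k + 1"
    by (elim oddE)
  then show ?thesis
    by simp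
qed simp

text \<open>The word \<open>(10)\<^sup>m\<close> is coded by the starting point \<open>a + m d\<close> with \<open>d = 1 - 2 a\<close>.\<close>

lemma alternating_factor:
  assumes "0 < a" "a < 1 / 2" "real m * (1 - 2 * a) < 1 - a"
  obtains x where "\<And>n. n < 2 * m \<Longrightarrow> rotation_letter a x n = (if even n then 1 else 0)"
proof
  define d where "d = 1 - 2 * a"
  define x where "x = a + real m * d"
  have d: "d > 0" "a = (1 - d) / 2"
    using assms by (auto simp: d_def field_simps)
  \<comment> \<open>Two steps of the rotation move a point by \<open>2 a = 1 - d\<close>, that is,
    by \<open>- d\<close> modulo 1. The even positions therefore descend from
    \<open>a + m d < 1\<close> to \<open>a\<close>, and the odd ones from \<open>(m - 1) d\<close>
    to 0.\<close>
  have fl: "\<lfloor>x + a * real n\<rfloor> = int ((n + 1) div 2)" if "n \<le> 2 * m" for n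
  proof (cases "even n")
    case True
    then obtain j where n: "n = 2 * j"
      by blast
    have "0 \<le> (real m - real j) * d" "(real m - real j) * d \<le> real m * d"
      using that n d by (auto intro: mult_right_mono)
    moreover have "x + a * real n = a + (real m - real j) * d + real j"
      by (simp add: x_def n d_def algebra_simps)
    ultimately have "\<lfloor>x + a * real n\<rfloor> = int j"
      using assms unfolding d_def[symmetric] by (intro floor_unique) simp_all
    then show ?thesis
      using n by simp
  next
    case False
    then obtain j where n: "n = 2 * j + 1"
      by (elim oddE)
    have "j + 1 \<le> m"
      using that n by simp
    then have "1 * d \<le> (real m - real j) * d"
      using d(1) by (intro mult_right_mono) auto
    moreover have "(real m - real j) * d \<le> real m * d"
      using d(1) by (intro mult_right_mono) auto
    moreover have "x + a * real n = 1 + ((real m - real j) * d - d) + real j"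
      by (simp add: x_def n d_def algebra_simps)
    moreover from calculation have "0 \<le> (real m - real j) * d - d" "(real m - real j) * d - d < 1"
      using assms(1,3) d(1) unfolding d_def[symmetric] by linarith+
    ultimately have "\<lfloor>x + a * real n\<rfloor> = int j + 1"
      by (intro floor_unique) linarith+
    then show ?thesis
      using n by simp
  qed
  fix n
  assume "n < 2 * m"
  then show "rotation_letter a x n = (if even n then 1 else 0)"
    using fl[of n] fl[of "Suc n"] int_div2_diff[of "Suc n"] by (simp add: rotation_letter_def)
qed

text \<open>The word \<open>(10)\<^sup>j(01)\<^sup>j\<close> is coded by the starting point \<open>max (a + j d) (2 j d)\<close>
  with \<open>d = 1 - 2 a\<close>.\<close>

lemma broken_alternating_factor:
  assumes "0 < a" "a < 1 / 2" "real (2 * j) * (1 - 2 * a) < 1"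
  obtains x where
    "\<And>n. n < 2 * j \<Longrightarrow> rotation_letter a x n = (if even n then 1 else 0)"
    "\<And>n. n < 2 * j \<Longrightarrow> rotation_letter a x (2 * j + n) = (if even n then 0 else 1)"
proof
  define d where "d = 1 - 2 * a"
  define x where "x = max (a + real j * d) (2 * (real j * d))"
  have d: "d > 0" "a = (1 - d) / 2"
    using assms by (auto simp: d_def field_simps)
  have jd: "2 * (real j * d) < 1"
    using assms(3) by (simp add: d_def)
  \<comment> \<open>These place the orbit in the right unit intervals. The two lower bounds serve
    the odd positions of the first half and the even positions of the second. The last two bound the
    remaining points from above; \<open>x + a\<close> concerns the odd positions of the second
    half.\<close>
  have x: "x \<ge> a + real j * d" "x \<ge> 2 * (real j * d)" "x < 1" "x + a < 1 + real j * d"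
    using jd d assms(2) unfolding x_def by linarith+
  have fl1: "\<lfloor>x + a * real n\<rfloor> = int ((n + 1) div 2)" if "n \<le> 2 * j" for n
  proof (cases "even n")
    case True
    then obtain i where n: "n = 2 * i"
      by blast
    have "0 \<le> real i * d" "real i * d \<le> real j * d"
      using that n d by (auto intro: mult_right_mono)
    moreover have "x + a * real n = x - real i * d + real i"
      by (simp add: n d_def algebra_simps)
    ultimately have "\<lfloor>x + a * real n\<rfloor> = int i"
      using x assms by (intro floor_unique) simp_all
    then show ?thesis
      using n by simp
  next
    case False
    then obtain i where n: "n = 2 * i + 1"
      by (elim oddE)
    have "i + 1 \<le> j"
      using that n by simp
    then have "(real i + 1) * d \<le> real j * d"
      using d(1) by (intro mult_right_mono) auto
    then have "real i * d + d \<le> real j * d"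
      by (simp add: algebra_simps)
    moreover have "0 \<le> real i * d"
      using d(1) by simp
    moreover have "x + a * real n = 1 + (x - a - (real i * d + d)) + real i"
      by (simp add: n d_def algebra_simps)
    moreover from calculation have "0 \<le> x - a - (real i * d + d)" "x - a - (real i * d + d) < 1"
      using x assms(1) d(1) by linarith+
    ultimately have "\<lfloor>x + a * real n\<rfloor> = int i + 1"
      by (intro floor_unique) linarith+
    then show ?thesis
      using n by simp
  qed
  have fl2: "\<lfloor>x + a * real (2 * j + n)\<rfloor> = int (j + n div 2)" if "n \<le> 2 * j" for n
  proof (cases "even n")
    case True
    then obtain i where n: "n = 2 * i"
      by blast
    have "0 \<le> real i * d" "real i * d \<le> real j * d" "0 \<le> real j * d"
      using that n d by (auto intro: mult_right_mono)
    moreover have "x + a * real (2 * j + n) = x - real j * d - real i * d + real (j + i)"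
      by (simp add: n d_def algebra_simps)
    ultimately have "\<lfloor>x + a * real (2 * j + n)\<rfloor> = int (j + i)"
      using x assms by (intro floor_unique) simp_all
    then show ?thesis
      using n by simp
  next
    case False
    then obtain i where n: "n = 2 * i + 1"
      by (elim oddE)
    have "0 \<le> real i * d" "real i * d \<le> real j * d"
      using that n d by (auto intro: mult_right_mono)
    moreover have "x + a * real (2 * j + n) = x + a - real j * d - real i * d + real (j + i)"
      by (simp add: n d_def algebra_simps)
    ultimately have "\<lfloor>x + a * real (2 * j + n)\<rfloor> = int (j + i)"
      using x assms by (intro floor_unique) simp_all
    then show ?thesis
      using n by simp
  qed
  fix n
  assume n: "n < 2 * j"
  then show "rotation_letter a x n = (if even n then 1 else 0)"
    using fl1[of n] fl1[of "Suc n"] int_div2_diff[of "Suc n"] by (simp add: rotation_letter_def)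
  have "rotation_letter a x (2 * j + n) =
        \<lfloor>x + a * real (2 * j + Suc n)\<rfloor> - \<lfloor>x + a * real (2 * j + n)\<rfloor>"
    by (simp add: rotation_letter_def)
  also have "\<dots> = (if even n then 0 else 1)"
    using n fl2[of n] fl2[of "Suc n"] int_div2_diff[of n] by simp
  finally show "rotation_letter a x (2 * j + n) = (if even n then 0 else 1)" .
qed

text \<open>The necessary condition is also sufficient: \<open>n\<close> and
  \<open>2 m - 1 - n\<close> have opposite parity, so the alternating word is an
  antipalindrome.\<close>

lemma antipalindrome_lengths_eq:
  assumes "a \<notin> \<rat>" "0 < a" "a < 1 / 2"
  shows "antipalindrome_lengths a = {2 * m |m. real m * (1 - 2 * a) < 1 - a}"
proof (intro set_eqI iffI)
  fix l
  assume "l \<in> antipalindrome_lengths a"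
  then show "l \<in> {2 * m |m. real m * (1 - 2 * a) < 1 - a}"
    using antipalindrome_length_less[of a l] assms by auto
next
  fix l
  assume "l \<in> {2 * m |m. real m * (1 - 2 * a) < 1 - a}"
  then obtain m where m: "l = 2 * m" "real m * (1 - 2 * a) < 1 - a"
    by blast
  obtain x where x: "\<And>n. n < 2 * m \<Longrightarrow> rotation_letter a x n = (if even n then 1 else 0)"
    using alternating_factor[OF assms(2,3) m(2)] by blast
  have "rotation_letter a x n = 1 - rotation_letter a x (l - Suc n)" if "n < l" for n
    using x[of n] x[of "l - Suc n"] that m(1) by auto
  then show "l \<in> antipalindrome_lengths a"
    using antipalindrome_lengths_iff[of a l] assms by auto
qed

text \<open>A shift by an odd \<open>k\<close> changes the parity of the position, so the
  alternating word of length \<open>2 k\<close> is an antisquare.\<close>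

lemma odd_antisquare_order:
  assumes "a \<notin> \<rat>" "0 < a" "a < 1 / 2" "odd k" "real k * (1 - 2 * a) < 1 - a"
  shows "k \<in> antisquare_orders a"
proof -
  obtain x where x: "\<And>n. n < 2 * k \<Longrightarrow> rotation_letter a x n = (if even n then 1 else 0)"
    using alternating_factor[OF assms(2,3,5)] by blast
  have "rotation_letter a x (k + m) = 1 - rotation_letter a x m" if "m < k" for m
    using x[of m] x[of "k + m"] that assms(4) by auto
  then show ?thesis
    using antisquare_orders_iff[of a k] assms by auto
qed

text \<open>For \<open>k = 2 j\<close> the word with the alternation broken in the middle is an
  antisquare. Its condition coincides with the necessary one in
  \<open>antisquare_order_less\<close>.\<close>

lemma even_antisquare_order:
  assumes "a \<notin> \<rat>" "0 < a" "a < 1 / 2" "even k" "real k * (1 - 2 * a) < 1"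
  shows "k \<in> antisquare_orders a"
proof -
  obtain j where k: "k = 2 * j"
    using assms(4) by blast
  obtain x where x:
    "\<And>n. n < 2 * j \<Longrightarrow> rotation_letter a x n = (if even n then 1 else 0)"
    "\<And>n. n < 2 * j \<Longrightarrow> rotation_letter a x (2 * j + n) = (if even n then 0 else 1)"
    using broken_alternating_factor[of a j] assms k by blast
  have "rotation_letter a x (k + m) = 1 - rotation_letter a x m" if "m < k" for m
    using x[of m] that k by auto
  then show ?thesis
    using antisquare_orders_iff[of a k] assms by auto
qed

lemma antisquare_antipalindrome_bounds:
  assumes "a \<notin> \<rat>" "0 < a" "a < 1 / 2"
  shows "finite (antisquare_orders a)" "finite (antipalindrome_lengths a)"
    and "0 \<in> antisquare_orders a" "0 \<in> antipalindrome_lengths a"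
    and "Max (antisquare_orders a) \<le> Max (antipalindrome_lengths a)"
    and "Max (antipalindrome_lengths a) \<le> 2 * Max (antisquare_orders a)"
proof -
  define d where "d = 1 - 2 * a"
  have d: "d > 0"
    using assms by (simp add: d_def)
  have bounded: "k \<le> nat \<lceil>1 / d\<rceil>" if "real k * d < 1" for k
  proof -
    have "real k < 1 / d"
      using that d by (simp add: field_simps)
    then show ?thesis
      by linarith
  qed
  have O: "real k * d < 1" if "k \<in> antisquare_orders a" for k
    using antisquare_order_less[OF assms(1,2) _ that] assms(3) by (simp add: d_def)
  then show fin_O: "finite (antisquare_orders a)"
    using bounded by (intro finite_subset[OF _ finite_atMost[of "nat \<lceil>1 / d\<rceil>"]]) auto
  have P: "antipalindrome_lengths a = {2 * m |m. real m * d < 1 - a}"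
    unfolding d_def by (rule antipalindrome_lengths_eq[OF assms])
  have "antipalindrome_lengths a \<subseteq> (*) 2 ` {..nat \<lceil>1 / d\<rceil>}"
    unfolding P using bounded assms(2) by force
  then show fin_P: "finite (antipalindrome_lengths a)"
    by (rule finite_subset) simp
  show zero_O: "0 \<in> antisquare_orders a"
    by (rule even_antisquare_order[OF assms]) simp_all
  show zero_P: "0 \<in> antipalindrome_lengths a"
    unfolding P using assms by auto
  define k where "k = Max (antisquare_orders a)"
  have "k \<in> antisquare_orders a"
    unfolding k_def using fin_O zero_O by (intro Max_in) auto
  then have k: "real k * d < 1"
    by (rule O)
  \<comment> \<open>\<open>2 m\<close> is \<open>k\<close> rounded up to an even number. From
    \<open>2 m \<le> k + 1\<close> and \<open>k d < 1\<close> follows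
    \<open>2 m d < 1 + d = 2 (1 - a)\<close>.\<close>
  define m where "m = (k + 1) div 2"
  have "k \<le> 2 * m" "2 * m \<le> k + 1"
    by (auto simp: m_def)
  then have "real (2 * m) * d \<le> real (k + 1) * d"
    using d by (intro mult_right_mono) auto
  then have "real m * d < 1 - a"
    using k by (simp add: d_def algebra_simps)
  then have "2 * m \<in> antipalindrome_lengths a"
    unfolding P by blast
  then show "Max (antisquare_orders a) \<le> Max (antipalindrome_lengths a)"
    using \<open>k \<le> 2 * m\<close> Max_ge[OF fin_P] by (fold k_def) (rule order_trans)
  have "Max (antipalindrome_lengths a) \<in> antipalindrome_lengths a"
    using fin_P zero_P by (intro Max_in) auto
  then obtain n where n: "Max (antipalindrome_lengths a) = 2 * n" "real n * d < 1 - a"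
    unfolding P by blast
  \<comment> \<open>The condition \<open>n d < 1 - a < 1\<close> suffices for either parity of
    \<open>n\<close>.\<close>
  have "n \<in> antisquare_orders a"
    using odd_antisquare_order[OF assms, of n] even_antisquare_order[OF assms, of n] n(2) assms(2)
    by (cases "even n") (auto simp: d_def)
  then show "Max (antipalindrome_lengths a) \<le> 2 * Max (antisquare_orders a)"
    using n(1) Max_ge[OF fin_O] by simp
qed

section \<open>Exchanging the letters\<close>

lemma exchange_exchange [simp]: "exchange (exchange w) = w"
  by (simp add: exchange_def o_def)

lemma length_exchange [simp]: "length (exchange w) = length w"
  by (simp add: exchange_def)

lemma exchange_append: "exchange (v @ w) = exchange v @ exchange w"
  by (simp add: exchange_def)

lemma exchange_rev: "exchange (rev w) = rev (exchange w)"
  by (simp add: exchange_def rev_map)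

lemma set_exchange_subset_01: "set (exchange w) \<subseteq> {0, 1} \<longleftrightarrow> set w \<subseteq> {0, 1}"
  by (auto simp: exchange_def)

lemma irrational_one_minus:
  fixes a :: real
  shows "1 - a \<notin> \<rat> \<longleftrightarrow> a \<notin> \<rat>"
proof -
  have "a \<in> \<rat>" if "1 - a \<in> \<rat>"
    using Rats_diff[OF Rats_1 that] by simp
  moreover have "1 - a \<in> \<rat>" if "a \<in> \<rat>"
    by (rule Rats_diff[OF Rats_1 that])
  ultimately show ?thesis
    by blast
qed

text \<open>For \<open>m \<ge> 1\<close> the number \<open>a m\<close> is not an integer, so the
  floors of \<open>a m\<close> and \<open>m - a m\<close> add up to \<open>m - 1\<close>. This fails
  at \<open>m = 0\<close>, hence the restriction to positive indices.\<close>

lemma sturmian_one_minus: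
  assumes "a \<notin> \<rat>" "0 < a" "a < 1" "n \<ge> 1"
  shows "sturmian (1 - a) n = 1 - sturmian a n"
proof -
  have fl: "\<lfloor>(1 - a) * real m\<rfloor> = int m - 1 - \<lfloor>a * real m\<rfloor>" if "m \<ge> 1" for m
  proof -
    have "a * real m \<notin> \<rat>"
    proof
      assume "a * real m \<in> \<rat>"
      then have "a * real m / real m \<in> \<rat>"
        by (intro Rats_divide) auto
      with that assms(1) show False
        by simp
    qed
    then have "a * real m \<noteq> of_int \<lfloor>a * real m\<rfloor>"
      by (metis Rats_of_int)
    then have "of_int \<lfloor>a * real m\<rfloor> < a * real m" "a * real m < of_int \<lfloor>a * real m\<rfloor> + 1"
      by linarith+
    then show ?thesis
      by (intro floor_unique) (simp_all add: algebra_simps)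
  qed
  have "\<lfloor>1 - a\<rfloor> = 0" "\<lfloor>a\<rfloor> = 0"
    using assms by (auto simp: floor_eq_iff)
  then show ?thesis
    unfolding sturmian_def using fl[of n] fl[of "n + 1"] assms(4) by simp
qed

lemma is_factor_one_minus:
  assumes "a \<notin> \<rat>" "0 < a" "a < 1" "is_factor a w"
  shows "is_factor (1 - a) (exchange w)"
proof -
  obtain i j where ij: "1 \<le> i" "w = map (sturmian a) [i..<Suc j]"
    using assms(4) unfolding is_factor_def by blast
  have "exchange w = map (sturmian (1 - a)) [i..<Suc j]"
    unfolding ij(2) exchange_def map_map
    by (rule map_cong) (use ij(1) sturmian_one_minus[OF assms(1-3)] in auto)
  with ij(1) show ?thesis
    unfolding is_factor_def by blast
qed

lemma antisquare_of_order_exchange: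
  assumes "antisquare_of_order k w"
  shows "antisquare_of_order k (exchange w)"
proof -
  obtain v where v: "set v \<subseteq> {0, 1}" "length v = k" "w = v @ exchange v"
    using assms unfolding antisquare_of_order_def by blast
  then show ?thesis
    unfolding antisquare_of_order_def
    by (intro exI[of _ "exchange v"]) (simp add: exchange_append set_exchange_subset_01)
qed

lemma antipalindrome_exchange:
  assumes "antipalindrome w"
  shows "antipalindrome (exchange w)"
proof -
  have "exchange w = exchange (rev (exchange w))"
    using assms by (metis antipalindrome_def exchange_rev)
  then show ?thesis
    using assms set_exchange_subset_01 unfolding antipalindrome_def by blast
qed

lemma antisquare_orders_subset_one_minus:
  assumes "a \<notin> \<rat>" "0 < a" "a < 1"
  shows "antisquare_orders a \<subseteq> antisquare_orders (1 - a)"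
  using is_factor_one_minus[OF assms] antisquare_of_order_exchange
  unfolding antisquare_orders_def by blast

lemma antipalindrome_lengths_subset_one_minus:
  assumes "a \<notin> \<rat>" "0 < a" "a < 1"
  shows "antipalindrome_lengths a \<subseteq> antipalindrome_lengths (1 - a)"
proof
  fix l
  assume "l \<in> antipalindrome_lengths a"
  then obtain w where "l = length (exchange w)" "is_factor a w" "antipalindrome w"
    unfolding antipalindrome_lengths_def by auto
  then show "l \<in> antipalindrome_lengths (1 - a)"
    using is_factor_one_minus[OF assms] antipalindrome_exchange
    unfolding antipalindrome_lengths_def by blast
qed

text \<open>The inclusions hold for \<open>a\<close> and for \<open>1 - a\<close>, and the two
  slopes trade places.\<close>

lemma one_minus_invariant:
  assumes "a \<notin> \<rat>" "0 < a" "a < 1"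
  shows "antisquare_orders (1 - a) = antisquare_orders a"
    and "antipalindrome_lengths (1 - a) = antipalindrome_lengths a"
  using antisquare_orders_subset_one_minus[of a] antisquare_orders_subset_one_minus[of "1 - a"]
    antipalindrome_lengths_subset_one_minus[of a]
    antipalindrome_lengths_subset_one_minus[of "1 - a"] irrational_one_minus[of a] assms
  by auto

section \<open>The maximal orders and lengths\<close>

lemma max_or_infinity_finite:
  assumes "finite S" "x \<in> S"
  shows "max_or_infinity S = enat (Max S)"
proof -
  have "Max S \<in> S" "\<forall>n\<in>S. n \<le> Max S"
    using assms by (auto intro: Max_in)
  then show ?thesis
    unfolding max_or_infinity_def by auto
qed

lemma antisquare_lengths_eq:
  "{length w |w. is_factor a w \<and> antisquare w} = (*) 2 ` antisquare_orders a"
proof -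
  have "length w = 2 * k" if "antisquare_of_order k w" for k w
    using that by (auto simp: antisquare_of_order_def)
  then show ?thesis
    unfolding antisquare_orders_def antisquare_def by (auto simp: image_iff) metis
qed

text \<open>One of \<open>a\<close> and \<open>1 - a\<close> lies below one half, and both have the
  same orders and lengths, so the bounds for small slopes carry over.\<close>

lemma A_O_A_P_A_L_eq_Max:
  assumes "a \<notin> \<rat>" "0 < a" "a < 1"
  shows "A_O a = enat (Max (antisquare_orders a))"
    and "A_P a = enat (Max (antipalindrome_lengths a))"
    and "A_L a = enat (2 * Max (antisquare_orders a))"
    and "Max (antisquare_orders a) \<le> Max (antipalindrome_lengths a)"
    and "Max (antipalindrome_lengths a) \<le> 2 * Max (antisquare_orders a)"
    and "Max (antipalindrome_lengths a) \<in> antipalindrome_lengths a"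
proof -
  have "a \<noteq> 1 / 2"
    using assms(1) by (metis Rats_1 Rats_divide Rats_number_of)
  then consider "a < 1 / 2" | "1 - a < 1 / 2"
    by fastforce
  then have *: "finite (antisquare_orders a) \<and> finite (antipalindrome_lengths a) \<and>
      0 \<in> antisquare_orders a \<and> 0 \<in> antipalindrome_lengths a \<and>
      Max (antisquare_orders a) \<le> Max (antipalindrome_lengths a) \<and>
      Max (antipalindrome_lengths a) \<le> 2 * Max (antisquare_orders a)"
  proof cases
    case 1
    then show ?thesis
      using antisquare_antipalindrome_bounds[of a] assms by blast
  next
    case 2
    then show ?thesis
      using antisquare_antipalindrome_bounds[of "1 - a"] assms irrational_one_minus[of a]
      unfolding one_minus_invariant[OF assms] by simp
  qed
  show "A_O a = enat (Max (antisquare_orders a))"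
    unfolding A_O_def antisquare_orders_def[symmetric] using * by (intro max_or_infinity_finite) auto
  show "A_P a = enat (Max (antipalindrome_lengths a))"
    unfolding A_P_def antipalindrome_lengths_def[symmetric] using *
    by (intro max_or_infinity_finite) auto
  have "A_L a = enat (Max ((*) 2 ` antisquare_orders a))"
    unfolding A_L_def antisquare_lengths_eq using * by (intro max_or_infinity_finite) auto
  also have "Max ((*) 2 ` antisquare_orders a) = 2 * Max (antisquare_orders a)"
    using * by (intro mono_Max_commute[symmetric]) (auto intro: monoI)
  finally show "A_L a = enat (2 * Max (antisquare_orders a))" .
  show "Max (antisquare_orders a) \<le> Max (antipalindrome_lengths a)"
    and "Max (antipalindrome_lengths a) \<le> 2 * Max (antisquare_orders a)"
    using * by auto
  show "Max (antipalindrome_lengths a) \<in> antipalindrome_lengths a"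
    using * by (intro Max_in) auto
qed

section \<open>Comparison with the continued fraction denominators\<close>

text \<open>Here \<open>c + 1 / v\<close> is the reciprocal of a slope below one half, and
  \<open>c * A + 1 + c\<close> has the form \<open>q_2 + q_1\<close> for partial quotients
  \<open>c\<close> and \<open>A\<close>. For \<open>c = 2\<close> the slope may be close to one half
  and \<open>v\<close> controls \<open>m\<close>; for \<open>c \<ge> 3\<close> only
  \<open>m \<le> 1\<close> is possible.\<close>

lemma half_length_less:
  fixes c A m :: nat and v :: real
  assumes "2 \<le> c" "1 < v" "v < real A + 1"
    and less: "real m * (real c + 1 / v - 2) < real c + 1 / v - 1"
  shows "2 * m < c * A + 1 + c"
proof (cases "c = 2")
  case True
  with less have "real m / v < 1 + 1 / v"
    by simp
  then have "real m < v + 1"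
    using assms(2) by (simp add: field_simps)
  with assms(3) have "real m < real (A + 2)"
    by simp
  then have "m < A + 2"
    by linarith
  with True show ?thesis
    by simp
next
  case False
  have "m < 2"
  proof (rule ccontr)
    assume "\<not> m < 2"
    define w where "w = real c + 1 / v"
    have "real c \<ge> 3" "1 / v > 0"
      using assms(1,2) False by auto
    then have w: "w > 3"
      unfolding w_def by linarith
    with \<open>\<not> m < 2\<close> have "2 * (w - 2) \<le> real m * (w - 2)"
      by (intro mult_right_mono) auto
    also have "\<dots> < w - 1"
      using less by (simp add: w_def)
    finally show False
      using w by simp
  qed
  with assms(1) False show ?thesis
    by simp
qed

text \<open>If the first partial quotient is at least 2, the estimate applies to \<open>a\<close>
  and gives \<open>q_2 + q_1 \<le> q_3\<close>. If it is 1, the estimate applies to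
  \<open>1 - a\<close>, whose expansion begins with \<open>a_2 + 1\<close> and continues with
  \<open>a_3\<close>; this gives \<open>q_3 + q_2 \<le> q_4\<close>.\<close>

lemma antipalindrome_length_less_cf_denom:
  assumes "a \<notin> \<rat>" "0 < a" "a < 1" "l \<in> antipalindrome_lengths a"
  shows "l < cf_denom a 4"
proof -
  define u where "u n = cf_complete a n" for n
  define c where "c n = cf_coeff a n" for n
  have u_gt: "u (Suc n) > 1" for n
    unfolding u_def by (rule cf_complete_Suc_gt_1[OF assms(1)])
  have u_eq: "u (Suc n) = real (c (Suc n)) + 1 / u (Suc (Suc n))" for n
    unfolding u_def c_def by (rule cf_complete_eq[OF assms(1)])
  have u_less: "u (Suc n) < real (c (Suc n)) + 1" for n
    unfolding u_def c_def by (rule cf_complete_less[OF assms(1)])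
  have a_eq: "a = 1 / u 1"
    using assms(2,3) by (simp add: u_def frac_eq)
  \<comment> \<open>Multiplies the condition on \<open>m\<close> by the reciprocal \<open>U\<close>
    of the slope.\<close>
  have scale: "real m * (U - 2) < U - 1"
    if "real m * (1 - 2 * (1 / U)) < 1 - 1 / U" "U > 1" for m and U :: real
  proof -
    have "real m * (U - 2) = (real m * (1 - 2 * (1 / U))) * U"
      using that(2) by (simp add: field_simps)
    also have "\<dots> < (1 - 1 / U) * U"
      using that by (intro mult_strict_right_mono) auto
    also have "\<dots> = U - 1"
      using that(2) by (simp add: field_simps)
    finally show ?thesis .
  qed
  show ?thesis
  proof (cases "c 1 \<ge> 2")
    case True
    obtain m where m: "l = 2 * m" "real m * (1 - 2 * a) < 1 - a"
      using antipalindrome_length_less[OF assms] by blast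
    have "real m * (u 1 - 2) < u 1 - 1"
      by (rule scale) (use m(2) a_eq u_gt[of 0] in auto)
    then have "2 * m < c 1 * c 2 + 1 + c 1"
      using half_length_less[OF True, of "u 2" "c 2" m] u_eq[of 0] u_gt[of 1] u_less[of 1]
      by (simp add: numeral_2_eq_2)
    also have "\<dots> = cf_denom a 2 + cf_denom a 1"
      by (simp add: c_def numeral_2_eq_2)
    also have "\<dots> \<le> cf_denom a 3"
      using cf_denom_add_le[OF assms(1), of 1] by (simp add: numeral_eq_Suc del: cf_denom.simps)
    also have "\<dots> \<le> cf_denom a 4"
      by (rule cf_denom_mono[OF assms(1)]) simp
    finally show ?thesis
      using m(1) by simp
  next
    case False
    then have c1: "c 1 = 1"
      using cf_coeff_pos[OF assms(1), of 0] by (simp add: c_def)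
    have c2: "c 2 \<ge> 1"
      using cf_coeff_pos[OF assms(1), of 1] by (simp add: c_def numeral_2_eq_2)
    have "u 2 > 1"
      using u_gt[of 1] by (simp add: numeral_2_eq_2)
    then have a': "1 - a = 1 / (1 + u 2)"
      using a_eq u_eq[of 0] c1 by (simp add: numeral_2_eq_2 field_simps)
    have "l \<in> antipalindrome_lengths (1 - a)"
      using assms(4) one_minus_invariant[OF assms(1-3)] by simp
    then obtain m where m: "l = 2 * m" "real m * (1 - 2 * (1 - a)) < 1 - (1 - a)"
      using antipalindrome_length_less[of "1 - a" l] assms irrational_one_minus[of a] by auto
    have "real m * ((1 + u 2) - 2) < (1 + u 2) - 1"
      by (rule scale) (use m(2) a' \<open>u 2 > 1\<close> in auto)
    then have "2 * m < (c 2 + 1) * c 3 + 1 + (c 2 + 1)"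
      using half_length_less[of "c 2 + 1" "u 3" "c 3" m] c2 u_eq[of 1] u_gt[of 2] u_less[of 2]
      by (simp add: numeral_eq_Suc algebra_simps)
    also have "\<dots> = cf_denom a 3 + cf_denom a 2"
      using c1 by (simp add: c_def numeral_eq_Suc)
    also have "\<dots> \<le> cf_denom a 4"
      using cf_denom_add_le[OF assms(1), of 2] by (simp add: numeral_eq_Suc del: cf_denom.simps)
    finally show ?thesis
      using m(1) by simp
  qed
qed

lemma maximal_orders_and_lengths:
  assumes a: "a \<notin> \<rat>" "0 < a" "a < 1"
  shows "A_O a \<noteq> \<infinity> \<and> A_P a \<noteq> \<infinity> \<and> A_L a \<noteq> \<infinity> \<and>
    ostrowski_length a (the_enat (A_O a)) \<le> 4 \<and>
    ostrowski_length a (the_enat (A_P a)) \<le> 4 \<and>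
    ostrowski_length a (the_enat (A_L a)) \<le> 6 \<and>
    A_O a \<le> A_P a \<and> A_P a \<le> A_L a \<and> A_L a = 2 * A_O a"
proof (intro conjI)
  note Max = A_O_A_P_A_L_eq_Max[OF a]
  show "A_O a \<noteq> \<infinity>" "A_P a \<noteq> \<infinity>" "A_L a \<noteq> \<infinity>" "A_O a \<le> A_P a" "A_P a \<le> A_L a"
    using Max by auto
  show "A_L a = 2 * A_O a"
    using Max by (simp add: numeral_eq_enat)
  have P: "Max (antipalindrome_lengths a) < cf_denom a 4"
    by (rule antipalindrome_length_less_cf_denom[OF a Max(6)])
  \<comment> \<open>Doubling costs two indices:
    \<open>2 q_4 \<le> q_5 + q_4 \<le> q_6\<close>.\<close>
  have "2 * cf_denom a 4 \<le> cf_denom a 5 + cf_denom a 4"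
    using cf_denom_mono[OF a(1), of 4 5] by simp
  also have "\<dots> \<le> cf_denom a 6"
    using cf_denom_add_le[OF a(1), of 4] by (simp add: numeral_eq_Suc del: cf_denom.simps)
  finally have L: "2 * Max (antisquare_orders a) < cf_denom a 6"
    using P Max(4) by linarith
  show "ostrowski_length a (the_enat (A_O a)) \<le> 4" "ostrowski_length a (the_enat (A_P a)) \<le> 4"
    "ostrowski_length a (the_enat (A_L a)) \<le> 6"
    using P L Max(4) ostrowski_length_le[OF a(1)] by (simp_all add: Max(1-3))
qed

section \<open>The two cases of equality\<close>

text \<open>Both maxima are 2. Order 2 occurs because \<open>2 (1 - 2 a) < 1\<close> for
  \<open>a > 1 / 4\<close>, while an antipalindrome of length at least 4 would require
  \<open>2 (1 - 2 a) < 1 - a\<close>, that is, \<open>a > 1 / 3\<close>.\<close>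

lemma A_O_eq_A_P:
  assumes "a \<notin> \<rat>" "1 / 4 < a" "a < 1 / 3"
  shows "A_O a = A_P a"
proof -
  have a: "0 < a" "a < 1"
    using assms by simp_all
  note Max = A_O_A_P_A_L_eq_Max[OF assms(1) a]
  have "2 \<in> antisquare_orders a"
    by (rule even_antisquare_order) (use assms in auto)
  then have two: "2 \<le> Max (antisquare_orders a)"
    using antisquare_antipalindrome_bounds(1)[of a] assms by (intro Max_ge) auto
  obtain m where m: "Max (antipalindrome_lengths a) = 2 * m" "real m * (1 - 2 * a) < 1 - a"
    using antipalindrome_length_less[OF assms(1) a Max(6)] by blast
  have "m \<le> 1"
  proof (rule ccontr)
    assume "\<not> m \<le> 1"
    then have "2 * (1 - 2 * a) \<le> real m * (1 - 2 * a)"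
      using assms by (intro mult_right_mono) auto
    also note m(2)
    finally show False
      using assms by simp
  qed
  with two m(1) Max(4) have "Max (antisquare_orders a) = Max (antipalindrome_lengths a)"
    by linarith
  then show ?thesis
    by (simp add: Max(1,2))
qed

text \<open>For \<open>a < 1 / 4\<close> an antisquare has order at most 1. The longest
  antipalindrome has even length between \<open>A_O\<close> and \<open>2 A_O\<close>, and the only
  even number there is \<open>2 A_O\<close>.\<close>

lemma A_P_eq_A_L:
  assumes "a \<notin> \<rat>" "0 < a" "a < 1 / 4"
  shows "A_P a = A_L a"
proof -
  have a: "a < 1"
    using assms by simp
  note Max = A_O_A_P_A_L_eq_Max[OF assms(1,2) a]
  have "Max (antisquare_orders a) \<in> antisquare_orders a"
    using antisquare_antipalindrome_bounds(1,3)[of a] assms by (intro Max_in) auto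
  then have less: "real (Max (antisquare_orders a)) * (1 - 2 * a) < 1"
    by (rule antisquare_order_less[OF assms(1,2) a])
  have "Max (antisquare_orders a) \<le> 1"
  proof (rule ccontr)
    assume "\<not> Max (antisquare_orders a) \<le> 1"
    then have "2 * (1 - 2 * a) \<le> real (Max (antisquare_orders a)) * (1 - 2 * a)"
      using assms by (intro mult_right_mono) auto
    also note less
    finally show False
      using assms by simp
  qed
  moreover obtain m where "Max (antipalindrome_lengths a) = 2 * m"
    using antipalindrome_length_less[OF assms(1,2) a Max(6)] by blast
  ultimately have "Max (antipalindrome_lengths a) = 2 * Max (antisquare_orders a)"
    using Max(4,5) by presburger
  then show ?thesis
    by (simp add: Max(2,3))
qed

theorem theorem7p6:
  shows "(\<forall>a::real. a \<notin> \<rat> \<and> 0 < a \<and> a < 1 \<longrightarrow>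
            A_O a \<noteq> \<infinity> \<and> A_P a \<noteq> \<infinity> \<and> A_L a \<noteq> \<infinity> \<and>
            ostrowski_length a (the_enat (A_O a)) \<le> 4 \<and>
            ostrowski_length a (the_enat (A_P a)) \<le> 4 \<and>
            ostrowski_length a (the_enat (A_L a)) \<le> 6 \<and>
            A_O a \<le> A_P a \<and> A_P a \<le> A_L a \<and> A_L a = 2 * A_O a) \<and>
         (\<exists>a \<beta>::real. a \<notin> \<rat> \<and> 0 < a \<and> a < 1 \<and> \<beta> \<notin> \<rat> \<and> 0 < \<beta> \<and> \<beta> < 1 \<and>
            A_O a = A_P a \<and> A_P \<beta> = A_L \<beta>)"
proof (intro conjI allI impI)
  show "\<exists>a \<beta>::real. a \<notin> \<rat> \<and> 0 < a \<and> a < 1 \<and> \<beta> \<notin> \<rat> \<and> 0 < \<beta> \<and> \<beta> < 1 \<and>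
          A_O a = A_P a \<and> A_P \<beta> = A_L \<beta>"
  proof -
    obtain a :: real where a: "a \<notin> \<rat>" "1 / 4 < a" "a < 1 / 3"
      using exists_irrational_between[of "1 / 4" "1 / 3"] by auto
    obtain \<beta> :: real where \<beta>: "\<beta> \<notin> \<rat>" "0 < \<beta>" "\<beta> < 1 / 4"
      using exists_irrational_between[of 0 "1 / 4"] by auto
    show ?thesis
      by (rule exI[of _ a], rule exI[of _ \<beta>])
        (use a \<beta> A_O_eq_A_P[OF a] A_P_eq_A_L[OF \<beta>] in auto)
  qed
qed (use maximal_orders_and_lengths in blast)+

end
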